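(* Let $n\ge2$ and let $t$ be a positive integer with $t\le n/2$. If an $(n-t,t)$-factorisation of $K_{2n}$ of index $1$ exists, then for every $k=t-1,t-2,\dots,1$, \[(2t-1)(2t-3)\cdots(2k+1)\ \text{ divides }\ (2n-(2t-1))(2n-(2t-3))\cdots(2n-(2k+1)).\] Equivalently, $\dfrac{(2(n-k)-1)!!\,(2k-1)!!}{(2(n-t)-1)!!\,(2t-1)!!}$ is an integer for every $k=t-1,t-2,\dots,1$.
   Context: A perfect matching of $K_{2n}$ is a set partition of $\{1,\dots,2n\}$ into pairs. For $\lambda\vdash n$, a set partition of $\{1,\dots,2n\}$ has shape $2\lambda$ if its block sizes are $2\lambda_1,2\lambda_2,\dots$. A non-empty set $D$ of perfect matchings is a $\lambda$-factorisation of index $c$ if for every set partition $P$ of shape $2\lambda$ exactly $c$ matchings in $D$ refine $P$ (each edge lies within a block of $P$). $(2m-1)!!=(2m-1)(2m-3)\cdots 1$. *)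

theory Defs
  imports Complex_Main "HOL-Library.Multiset" "HOL-Library.Disjoint_Sets"
begin

definition integer_partition :: "nat \<Rightarrow> nat list \<Rightarrow> bool" where
  "integer_partition n l \<longleftrightarrow> sorted_wrt (\<ge>) l \<and> (\<forall>x\<in>set l. x > 0) \<and> sum_list l = n"

definition perfect_matching :: "nat \<Rightarrow> nat set set \<Rightarrow> bool" where
  "perfect_matching n M \<longleftrightarrow> partition_on {1..2*n} M \<and> (\<forall>e\<in>M. card e = 2)"

text \<open>The block sizes, counted with multiplicity, are the doubled parts of \<open>l\<close>.\<close>

definition has_double_shape :: "nat \<Rightarrow> nat list \<Rightarrow> nat set set \<Rightarrow> bool" where
  "has_double_shape n l P \<longleftrightarrow>
     partition_on {1..2*n} P \<and> image_mset card (mset_set P) = mset (map (\<lambda>x. 2 * x) l)"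

definition factorisation :: "nat \<Rightarrow> nat list \<Rightarrow> nat \<Rightarrow> nat set set set \<Rightarrow> bool" where
  "factorisation n l c D \<longleftrightarrow>
     integer_partition n l \<and> D \<noteq> {} \<and> (\<forall>M\<in>D. perfect_matching n M) \<and>
     (\<forall>P. has_double_shape n l P \<longrightarrow> card {M\<in>D. refines {1..2*n} M P} = c)"

fun double_fact :: "nat \<Rightarrow> nat" where
  "double_fact 0 = 1"
| "double_fact (Suc 0) = 1"
| "double_fact (Suc (Suc m)) = Suc (Suc m) * double_fact m"

end

theory Submission
  imports Defs
begin

text \<open>
  Call \<open>S\<close> saturated by a matching \<open>M\<close> if \<open>S\<close> is a union of edges of \<open>M\<close>, and let \<open>N(S)\<close> be the number
  of members of \<open>D\<close> that saturate \<open>S\<close>; by hypothesis \<open>N(S) = 1\<close> whenever \<open>S\<close> has \<open>2t\<close> or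
  \<open>2(n - t)\<close> elements. Fix a set \<open>K\<close> with \<open>2k\<close> elements. If \<open>w\<close> edges of \<open>M\<close> lie inside \<open>K\<close>, then
  \<open>n - 2k + w\<close> edges avoid \<open>K\<close>, so counting the saturated sets of size \<open>2(n - t)\<close> that avoid \<open>K\<close>
  evaluates the sum over \<open>M \<in> D\<close> of \<open>(n - 2k + w) choose (n - t)\<close>. Vandermonde expands this in the
  moments \<open>w choose i\<close>, whose sums over \<open>D\<close> are the sums of \<open>N(L)\<close> over the \<open>2i\<close>-subsets \<open>L\<close> of \<open>K\<close>.
  The top moment \<open>i = k\<close> is \<open>N(K)\<close> itself and its coefficient \<open>(n - 2k) choose (n - t - k)\<close> is
  nonzero for \<open>k \<le> t\<close>, so by induction on \<open>k\<close> the number \<open>N(K)\<close> depends only on \<open>k\<close>. This constant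
  is an integer, and averaging over all \<open>K\<close> evaluates it as the quotient of double factorials.
\<close>

section \<open>Saturated sets of a perfect matching\<close>

text \<open>Phrased as "no edge crosses the boundary of \<open>S\<close>", which is what refinement
  of the partition into \<open>S\<close> and its complement amounts to.\<close>

definition saturated :: "'a set set \<Rightarrow> 'a set \<Rightarrow> bool" where
  "saturated M S \<longleftrightarrow> (\<forall>e\<in>M. e \<subseteq> S \<or> e \<inter> S = {})"

definition pairing_on :: "'a set \<Rightarrow> 'a set set \<Rightarrow> bool" where
  "pairing_on V M \<longleftrightarrow> partition_on V M \<and> (\<forall>e\<in>M. card e = 2)"

lemma finite_pairing: "finite V \<Longrightarrow> pairing_on V M \<Longrightarrow> finite M"
  by (auto simp: pairing_on_def intro: finite_elements)

lemma card_Union_pairing: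
  assumes "pairing_on V M" "T \<subseteq> M"
  shows "card (\<Union>T) = 2 * card T"
proof -
  have "card (\<Union>T) = sum card T"
    using assms
    by (intro card_Union_disjoint)
      (auto simp: pairing_on_def partition_on_def pairwise_def intro!: card_ge_0_finite)
  also have "\<dots> = (\<Sum>e\<in>T. 2)"
    using assms by (intro sum.cong) (auto simp: pairing_on_def)
  finally show ?thesis by simp
qed

lemma card_pairing: "pairing_on V M \<Longrightarrow> card V = 2 * card M"
  using card_Union_pairing[of V M M] by (simp add: pairing_on_def partition_on_def)

text \<open>Edges are nonempty and pairwise disjoint, so a union of edges determines which edges
  formed it.\<close>

lemma subset_Union_pairing_iff:
  assumes "pairing_on V M" "T \<subseteq> M" "e \<in> M"
  shows "e \<subseteq> \<Union>T \<longleftrightarrow> e \<in> T" "e \<inter> \<Union>T = {} \<longleftrightarrow> e \<notin> T"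
proof -
  have ne: "e \<noteq> {}" using assms by (auto simp: pairing_on_def)
  have dis: "e \<inter> f = {}" if "f \<in> T" "e \<notin> T" for f
    using assms that unfolding pairing_on_def partition_on_def disjoint_def by (metis subsetD)
  show "e \<subseteq> \<Union>T \<longleftrightarrow> e \<in> T" "e \<inter> \<Union>T = {} \<longleftrightarrow> e \<notin> T"
    using ne dis by blast+
qed

text \<open>A saturated set is the union of the edges inside it, so choosing it amounts to choosing
  \<open>i\<close> of the edges contained in \<open>U\<close>.\<close>

lemma card_saturated_subsets:
  assumes fin: "finite V" and M: "pairing_on V M" and U: "U \<subseteq> V"
  shows "card {S. S \<subseteq> U \<and> card S = 2 * i \<and> saturated M S} = card {e\<in>M. e \<subseteq> U} choose i"
proof -
  let ?A = "{T. T \<subseteq> {e\<in>M. e \<subseteq> U} \<and> card T = i}"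
  let ?B = "{S. S \<subseteq> U \<and> card S = 2 * i \<and> saturated M S}"
  have "bij_betw Union ?A ?B"
  proof (rule bij_betw_byWitness[where f' = "\<lambda>S. {e\<in>M. e \<subseteq> S}"])
    show "\<forall>T\<in>?A. {e\<in>M. e \<subseteq> \<Union>T} = T"
    proof
      fix T assume "T \<in> ?A"
      then have "T \<subseteq> M" by auto
      then show "{e\<in>M. e \<subseteq> \<Union>T} = T"
        using subset_Union_pairing_iff(1)[OF M] by blast
    qed
    have eq: "\<Union>{e\<in>M. e \<subseteq> S} = S" if "S \<subseteq> U" "saturated M S" for S
    proof -
      have "S \<subseteq> \<Union>M" using that U M by (auto simp: pairing_on_def partition_on_def)
      show ?thesis
      proof (intro equalityI subsetI)
        fix x assume "x \<in> S"
        then obtain e where "e \<in> M" "x \<in> e" using \<open>S \<subseteq> \<Union>M\<close> by blast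
        then show "x \<in> \<Union>{e\<in>M. e \<subseteq> S}"
          using \<open>x \<in> S\<close> \<open>saturated M S\<close> unfolding saturated_def by blast
      qed blast
    qed
    then show "\<forall>S\<in>?B. \<Union>{e\<in>M. e \<subseteq> S} = S" by simp
    show "Union ` ?A \<subseteq> ?B"
    proof (intro image_subsetI)
      fix T assume T: "T \<in> ?A"
      then have "T \<subseteq> M" by auto
      then have "saturated M (\<Union>T)"
        using subset_Union_pairing_iff[OF M] unfolding saturated_def by meson
      moreover have "\<Union>T \<subseteq> U" using T by blast
      moreover have "card (\<Union>T) = 2 * i"
        using T card_Union_pairing[OF M \<open>T \<subseteq> M\<close>] by simp
      ultimately show "\<Union>T \<in> ?B" by simp
    qed
    show "(\<lambda>S. {e\<in>M. e \<subseteq> S}) ` ?B \<subseteq> ?A"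
    proof (intro image_subsetI)
      fix S assume S: "S \<in> ?B"
      have "card (\<Union>{e\<in>M. e \<subseteq> S}) = 2 * card {e\<in>M. e \<subseteq> S}"
        by (rule card_Union_pairing[OF M]) auto
      then have "card {e\<in>M. e \<subseteq> S} = i" using S eq by simp
      then show "{e\<in>M. e \<subseteq> S} \<in> ?A" using S by auto
    qed
  qed
  then have "card ?B = card ?A" by (rule bij_betw_same_card[symmetric])
  then show ?thesis
    using n_subsets[of "{e\<in>M. e \<subseteq> U}" i] finite_pairing[OF fin M] by simp
qed

text \<open>Sum over all edges the local identity
  \<open>[e avoids K] + card (e \<inter> K) = 1 + [e \<subseteq> K]\<close>. The additive form
  avoids truncated subtraction.\<close>

lemma card_edges_avoiding:
  assumes fin: "finite V" and M: "pairing_on V M" and K: "K \<subseteq> V"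
  shows "card {e\<in>M. e \<subseteq> V - K} + card K = card M + card {e\<in>M. e \<subseteq> K}"
proof -
  have finM: "finite M" by (rule finite_pairing[OF fin M])
  have UM: "\<Union>M = V" and dj: "disjoint M" and c2: "\<And>e. e \<in> M \<Longrightarrow> card e = 2"
    using M by (auto simp: pairing_on_def partition_on_def)
  have "K = (\<Union>e\<in>M. e \<inter> K)" using UM K by auto
  then have "card K = card (\<Union>e\<in>M. e \<inter> K)" by simp
  also have "\<dots> = (\<Sum>e\<in>M. card (e \<inter> K))"
    using dj finM fin UM K
    by (intro card_UN_disjoint) (auto simp: disjoint_def intro: finite_subset)
  finally have cK: "card K = (\<Sum>e\<in>M. card (e \<inter> K))" .
  have ind: "card {e\<in>M. P e} = (\<Sum>e\<in>M. if P e then 1 else 0)" for P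
    using finM by (simp add: sum.If_cases Int_def)
  have "(\<Sum>e\<in>M. (if e \<subseteq> V - K then 1 else 0) + card (e \<inter> K))
      = (\<Sum>e\<in>M. 1 + (if e \<subseteq> K then 1 else 0))"
  proof (rule sum.cong[OF refl])
    fix e assume e: "e \<in> M"
    obtain a b where ab: "e = {a, b}" "a \<noteq> b" using c2[OF e] by (auto simp: card_2_iff)
    have "e \<subseteq> V" using e UM by auto
    then show "(if e \<subseteq> V - K then 1 else 0) + card (e \<inter> K) = 1 + (if e \<subseteq> K then 1 else 0)"
      using ab by (cases "a \<in> K"; cases "b \<in> K") (auto simp: Int_insert_left)
  qed
  then show ?thesis by (simp only: sum.distrib ind cK) simp
qed

text \<open>Double counting of the pairs of a set \<open>S\<close> and a matching in
  \<open>D\<close> that saturates it.\<close>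

lemma sum_saturation_counts:
  assumes fin: "finite V" and U: "U \<subseteq> V" and D: "finite D" "\<And>M. M \<in> D \<Longrightarrow> pairing_on V M"
  shows "(\<Sum>S | S \<subseteq> U \<and> card S = 2 * i. card {M\<in>D. saturated M S})
       = (\<Sum>M\<in>D. card {e\<in>M. e \<subseteq> U} choose i)"
proof -
  let ?A = "{S. S \<subseteq> U \<and> card S = 2 * i}"
  have "finite U" using fin U finite_subset by auto
  then have finA: "finite ?A" by simp
  have "(\<Sum>S\<in>?A. card {M\<in>D. saturated M S}) = (\<Sum>S\<in>?A. \<Sum>M\<in>{M. M \<in> D \<and> saturated M S}. 1)"
    by simp
  also have "\<dots> = (\<Sum>M\<in>D. \<Sum>S\<in>{S. S \<in> ?A \<and> saturated M S}. 1)"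
    by (rule sum.swap_restrict[OF finA D(1)])
  also have "\<dots> = (\<Sum>M\<in>D. card {e\<in>M. e \<subseteq> U} choose i)"
    using card_saturated_subsets[OF fin D(2) U, of _ i]
    by (intro sum.cong) (auto simp: conj_assoc)
  finally show ?thesis .
qed

section \<open>Saturation counts depend only on the size of the set\<close>

lemma saturation_count_constant:
  assumes fin: "finite V" and cV: "card V = 2 * n"
    and D: "finite D" "\<And>M. M \<in> D \<Longrightarrow> pairing_on V M"
    and tn: "2 * t \<le> n"
    and index: "\<And>R. R \<subseteq> V \<Longrightarrow> card R = 2 * (n - t) \<Longrightarrow> card {M\<in>D. saturated M R} = c"
    and "k \<le> t"
  shows "\<exists>d. \<forall>K. K \<subseteq> V \<longrightarrow> card K = 2 * k \<longrightarrow> card {M\<in>D. saturated M K} = d"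
  using \<open>k \<le> t\<close>
proof (induction k rule: less_induct)
  case (less k)
  have "\<forall>i<k. \<exists>d. \<forall>K. K \<subseteq> V \<longrightarrow> card K = 2 * i \<longrightarrow> card {M\<in>D. saturated M K} = d"
    using less by auto
  then obtain d where d: "\<And>i K. i < k \<Longrightarrow> K \<subseteq> V \<Longrightarrow> card K = 2 * i \<Longrightarrow> card {M\<in>D. saturated M K} = d i"
    by metis
  let ?a = "\<lambda>i. (n - 2 * k) choose (n - t - i)"
  \<comment> \<open>Both sides count pairs of a matching in \<open>D\<close> and a saturated set of
    size \<open>2 * (n - t)\<close> disjoint from \<open>K\<close>. On the right only the last term
    involves \<open>K\<close>.\<close>
  have recursion: "c * (2 * (n - k) choose (2 * (n - t)))
      = (\<Sum>i<k. ?a i * (d i * (2 * k choose (2 * i)))) + ?a k * card {M\<in>D. saturated M K}"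
    if K: "K \<subseteq> V" and cK: "card K = 2 * k" for K
  proof -
    have finK: "finite K" using K fin finite_subset by auto
    define w where "w M = card {e\<in>M. e \<subseteq> K}" for M
    \<comment> \<open>Written as a sum, ready for Vandermonde; \<open>2 * k \<le> n\<close> makes
      the subtraction exact.\<close>
    have w: "card {e\<in>M. e \<subseteq> V - K} = w M + (n - 2 * k)" if "M \<in> D" for M
      using card_edges_avoiding[OF fin D(2)[OF that] K] card_pairing[OF D(2)[OF that]] cV cK less.prems tn
      by (simp add: w_def)
    have w_le: "w M \<le> k" if M: "M \<in> D" for M
    proof -
      have "2 * w M = card (\<Union>{e\<in>M. e \<subseteq> K})"
        unfolding w_def by (subst card_Union_pairing[OF D(2)[OF M]]) auto
      also have "\<dots> \<le> card K" using finK by (intro card_mono) auto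
      finally show ?thesis using cK by simp
    qed
    have moment: "(\<Sum>M\<in>D. w M choose i) = d i * (2 * k choose (2 * i))" if "i < k" for i
    proof -
      have "(\<Sum>M\<in>D. w M choose i) = (\<Sum>S | S \<subseteq> K \<and> card S = 2 * i. card {M\<in>D. saturated M S})"
        unfolding w_def by (rule sum_saturation_counts[OF fin K D, symmetric])
      also have "\<dots> = (\<Sum>S | S \<subseteq> K \<and> card S = 2 * i. d i)"
        using d[OF that] K by (intro sum.cong) auto
      finally show ?thesis using n_subsets[OF finK] cK by simp
    qed
    have top_moment: "(\<Sum>M\<in>D. w M choose k) = card {M\<in>D. saturated M K}"
    proof -
      have "{S. S \<subseteq> K \<and> card S = 2 * k} = {K}"
        using finK cK by (auto dest: card_subset_eq[rotated])
      then show ?thesis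
        using sum_saturation_counts[OF fin K D, of k] by (simp add: w_def)
    qed
    have "card (V - K) = 2 * (n - k)"
      using card_Diff_subset[OF finK K] cV cK by simp
    then have "c * (2 * (n - k) choose (2 * (n - t))) = (\<Sum>S | S \<subseteq> V - K \<and> card S = 2 * (n - t). c)"
      using n_subsets[of "V - K" "2 * (n - t)"] fin by simp
    also have "\<dots> = (\<Sum>S | S \<subseteq> V - K \<and> card S = 2 * (n - t). card {M\<in>D. saturated M S})"
      using index by (intro sum.cong) auto
    also have "\<dots> = (\<Sum>M\<in>D. card {e\<in>M. e \<subseteq> V - K} choose (n - t))"
      by (rule sum_saturation_counts[OF fin _ D]) auto
    also have "\<dots> = (\<Sum>M\<in>D. \<Sum>i\<le>n - t. (w M choose i) * ?a i)"
      by (intro sum.cong refl) (simp only: w vandermonde)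
    \<comment> \<open>Terms with \<open>i > k\<close> vanish since \<open>w M \<le> k\<close>;
      moreover \<open>k \<le> t \<le> n - t\<close>, so the range really shrinks.\<close>
    also have "\<dots> = (\<Sum>M\<in>D. \<Sum>i\<le>k. (w M choose i) * ?a i)"
    proof (intro sum.cong[OF refl] sum.mono_neutral_right)
      fix M assume "M \<in> D"
      then show "\<forall>i\<in>{..n - t} - {..k}. (w M choose i) * ?a i = 0"
        using w_le by (fastforce simp: binomial_eq_0)
    qed (use less.prems tn in auto)
    also have "\<dots> = (\<Sum>i\<le>k. ?a i * (\<Sum>M\<in>D. w M choose i))"
      by (subst sum.swap) (simp add: sum_distrib_right mult.commute)
    also have "\<dots> = (\<Sum>i<k. ?a i * (d i * (2 * k choose (2 * i)))) + ?a k * card {M\<in>D. saturated M K}"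
      by (simp add: lessThan_Suc_atMost[symmetric] moment top_moment)
    finally show ?thesis .
  qed
  \<comment> \<open>Here \<open>k \<le> t\<close> gives \<open>n - t - k \<le> n - 2 * k\<close>, so
    the unknown count can be cancelled out of the recursion.\<close>
  have "?a k > 0" using less.prems tn by simp
  then have eq: "card {M\<in>D. saturated M K} = card {M\<in>D. saturated M L}"
    if "K \<subseteq> V" "card K = 2 * k" "L \<subseteq> V" "card L = 2 * k" for K L
    using recursion[OF that(1,2)] recursion[OF that(3,4)] by simp
  show ?case
  proof (cases "\<exists>L. L \<subseteq> V \<and> card L = 2 * k")
    case True
    then obtain L where "L \<subseteq> V" "card L = 2 * k" by blast
    then show ?thesis using eq[OF _ _ \<open>L \<subseteq> V\<close>] by blast
  qed blast
qed

text \<open>Double counting with \<open>U = V\<close>: every edge lies in \<open>V\<close>, so each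
  matching saturates \<open>n choose k\<close> sets of size \<open>2 * k\<close>.\<close>

lemma saturation_count_total:
  assumes fin: "finite V" and cV: "card V = 2 * n"
    and D: "finite D" "\<And>M. M \<in> D \<Longrightarrow> pairing_on V M"
    and index: "\<And>K. K \<subseteq> V \<Longrightarrow> card K = 2 * k \<Longrightarrow> card {M\<in>D. saturated M K} = c"
  shows "c * (2 * n choose (2 * k)) = card D * (n choose k)"
proof -
  have "c * (2 * n choose (2 * k)) = (\<Sum>S | S \<subseteq> V \<and> card S = 2 * k. c)"
    using n_subsets[OF fin] cV by simp
  also have "\<dots> = (\<Sum>S | S \<subseteq> V \<and> card S = 2 * k. card {M\<in>D. saturated M S})"
    using index by (intro sum.cong) auto
  also have "\<dots> = (\<Sum>M\<in>D. card {e\<in>M. e \<subseteq> V} choose k)"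
    by (rule sum_saturation_counts[OF fin _ D]) auto
  also have "\<dots> = (\<Sum>M\<in>D. n choose k)"
  proof (intro sum.cong refl)
    fix M assume M: "M \<in> D"
    have "{e\<in>M. e \<subseteq> V} = M" using D(2)[OF M] by (auto simp: pairing_on_def partition_on_def)
    then show "card {e\<in>M. e \<subseteq> V} choose k = n choose k"
      using card_pairing[OF D(2)[OF M]] cV by simp
  qed
  finally show ?thesis by simp
qed

section \<open>Double factorials and binomial coefficients\<close>

lemma double_fact_pos: "double_fact m > 0"
  by (induction m rule: double_fact.induct) auto

text \<open>Valid also at \<open>m = 0\<close>, where truncated subtraction yields
  \<open>double_fact 0 = 1\<close>, the usual value of (-1)!!.\<close>

lemma double_fact_odd_Suc: "double_fact (2 * Suc m - 1) = (2 * m + 1) * double_fact (2 * m - 1)"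
  by (cases m) auto

lemma fact_double: "fact (2 * m) = 2 ^ m * fact m * double_fact (2 * m - 1)"
proof (induction m)
  case (Suc m)
  have "fact (2 * Suc m) = (2 * m + 2) * ((2 * m + 1) * (fact (2 * m) :: nat))"
    by (simp add: algebra_simps)
  then show ?case
    unfolding Suc.IH double_fact_odd_Suc by (simp add: algebra_simps)
qed simp

text \<open>After multiplication by \<open>?p\<close> both sides equal
  \<open>fact (2 * n)\<close>.\<close>

lemma binomial_double_fact:
  assumes "k \<le> n"
  shows "(2 * n choose (2 * k)) * (double_fact (2 * (n - k) - 1) * double_fact (2 * k - 1))
       = (n choose k) * double_fact (2 * n - 1)"
proof -
  let ?d = "\<lambda>m. double_fact (2 * m - 1)"
  let ?p = "2 ^ n * (fact k * fact (n - k)) :: nat"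
  have e: "2 * (n - k) = 2 * n - 2 * k" by simp
  have pow: "(2::nat) ^ n = 2 ^ k * 2 ^ (n - k)"
    using assms by (simp flip: power_add)
  have "?p * ((2 * n choose (2 * k)) * (?d (n - k) * ?d k))
      = (2 ^ k * fact k * ?d k) * (2 ^ (n - k) * fact (n - k) * ?d (n - k)) * (2 * n choose (2 * k))"
    unfolding pow by (simp only: mult_ac)
  also have "\<dots> = fact (2 * k) * fact (2 * n - 2 * k) * (2 * n choose (2 * k))"
    by (simp only: fact_double[symmetric] e[symmetric])
  also have "\<dots> = fact (2 * n)"
    using assms by (intro binomial_fact_lemma) simp
  also have "\<dots> = 2 ^ n * (fact k * fact (n - k) * (n choose k)) * ?d n"
    by (simp only: fact_double binomial_fact_lemma[OF assms])
  also have "\<dots> = ?p * ((n choose k) * ?d n)"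
    by (simp only: mult_ac)
  finally show ?thesis by simp
qed

lemma double_fact_odd_prod:
  "k \<le> t \<Longrightarrow> int (double_fact (2 * t - 1)) = (\<Prod>j=k+1..t. 2 * int j - 1) * int (double_fact (2 * k - 1))"
proof (induction t rule: dec_induct)
  case (step t)
  then show ?case
    unfolding double_fact_odd_Suc by (simp add: algebra_simps)
qed simp

lemma double_fact_odd_prod_reflected:
  "k \<le> t \<Longrightarrow> t \<le> n \<Longrightarrow> int (double_fact (2 * (n - k) - 1))
     = (\<Prod>j=k+1..t. 2 * int n - (2 * int j - 1)) * int (double_fact (2 * (n - t) - 1))"
proof (induction t rule: dec_induct)
  case (step t)
  have "n - t = Suc (n - Suc t)" using step by simp
  moreover have "int (2 * (n - Suc t) + 1) = 2 * int n - (2 * int (Suc t) - 1)"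
    using step.prems by simp
  ultimately have "int (double_fact (2 * (n - t) - 1))
      = (2 * int n - (2 * int (Suc t) - 1)) * int (double_fact (2 * (n - Suc t) - 1))"
    by (simp only: double_fact_odd_Suc of_nat_mult)
  then show ?case using step by simp
qed simp

section \<open>From factorisations to saturation counts\<close>

lemma refines_complement_iff:
  assumes M: "partition_on V M" and S: "S \<subseteq> V" "S \<noteq> {}" "S \<noteq> V"
  shows "refines V M {S, V - S} \<longleftrightarrow> saturated M S"
proof -
  have "partition_on V {S, V - S}"
    using S by (auto simp: partition_on_def disjoint_def)
  moreover have "e \<subseteq> V" if "e \<in> M" for e using M that by (auto simp: partition_on_def)
  ultimately show ?thesis
    using M by (auto simp: refines_def saturated_def)
qed

text \<open>Both sizes give the same two-block partition up to the order of its blocks. Size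
  \<open>2 * (n - t)\<close> feeds the induction, size \<open>2 * t\<close> determines
  \<open>card D\<close>.\<close>

lemma factorisation_saturation_count:
  assumes D: "factorisation n [n - t, t] c D" and t: "0 < t" "t < n"
    and S: "S \<subseteq> {1..2*n}" "card S = 2 * t \<or> card S = 2 * (n - t)"
  shows "card {M\<in>D. saturated M S} = c"
proof -
  let ?V = "{1..2*n}"
  have finS: "finite S" using S(1) finite_subset by auto
  have cC: "card (?V - S) = 2 * n - card S"
    using card_Diff_subset[OF finS S(1)] by simp
  have ne: "S \<noteq> {}" "S \<noteq> ?V" using S t by auto
  have "has_double_shape n [n - t, t] {S, ?V - S}"
    unfolding has_double_shape_def
  proof
    show "partition_on ?V {S, ?V - S}"
      using S(1) ne by (auto simp: partition_on_def disjoint_def)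
    \<comment> \<open>If \<open>2 * t = n\<close> the blocks have equal size; being distinct sets,
      they still contribute two entries.\<close>
    have "S \<noteq> ?V - S" using ne by blast
    then have "image_mset card (mset_set {S, ?V - S}) = {#card S, card (?V - S)#}" by simp
    then show "image_mset card (mset_set {S, ?V - S}) = mset (map (\<lambda>x. 2 * x) [n - t, t])"
      using S(2) cC t by (auto simp: diff_mult_distrib2)
  qed
  then have "card {M\<in>D. refines ?V M {S, ?V - S}} = c"
    using D by (simp add: factorisation_def)
  moreover have "{M\<in>D. refines ?V M {S, ?V - S}} = {M\<in>D. saturated M S}"
    using D refines_complement_iff[OF _ S(1) ne]
    by (auto simp: factorisation_def perfect_matching_def)
  ultimately show ?thesis by simp
qed

theorem mainTheorem8:
  fixes n t :: nat
  assumes "n \<ge> 2" and "t > 0" and "2 * t \<le> n"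
    and "\<exists>D. factorisation n [n - t, t] 1 D"
  shows "\<forall>k\<in>{1..<t}.
      (\<Prod>j=k+1..t. 2 * int j - 1) dvd (\<Prod>j=k+1..t. 2 * int n - (2 * int j - 1))
    \<and> (of_nat (double_fact (2 * (n - k) - 1) * double_fact (2 * k - 1))
       / of_nat (double_fact (2 * (n - t) - 1) * double_fact (2 * t - 1)) :: rat) \<in> \<int>"
proof
  fix k assume "k \<in> {1..<t}"
  then have kt: "k \<le> t" "k \<le> n" "t \<le> n" "t < n" using assms by auto
  obtain D where D: "factorisation n [n - t, t] 1 D" using assms by blast
  let ?V = "{1..2*n}" and ?d = "\<lambda>m. double_fact (2 * m - 1)"
  have pair: "\<And>M. M \<in> D \<Longrightarrow> pairing_on ?V M"
    using D by (auto simp: factorisation_def perfect_matching_def pairing_on_def)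
  have "D \<subseteq> Pow (Pow ?V)"
    using pair by (fastforce simp: pairing_on_def partition_on_def)
  then have finD: "finite D" by (rule finite_subset) simp
  note index = factorisation_saturation_count[OF D assms(2) kt(4)]
  obtain c where c: "\<And>K. K \<subseteq> ?V \<Longrightarrow> card K = 2 * k \<Longrightarrow> card {M\<in>D. saturated M K} = c"
    using saturation_count_constant[of ?V n D t 1 k] finD pair index assms(3) kt by auto
  have Ck: "c * (2 * n choose (2 * k)) = card D * (n choose k)"
    using saturation_count_total[of ?V n D k c] finD pair c by simp
  have Ct: "2 * n choose (2 * t) = card D * (n choose t)"
    using saturation_count_total[of ?V n D t 1] finD pair index by simp
  \<comment> \<open>Cross-multiplying by \<open>?x\<close> lets \<open>Ck\<close> and
    \<open>Ct\<close> eliminate \<open>card D\<close> without division.\<close>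
  let ?x = "(n choose k) * (n choose t) * ?d n"
  have "?x * (c * (?d (n - t) * ?d t)) = (n choose k) * c * (?d (n - t) * ?d t) * ((n choose t) * ?d n)"
    by (simp only: mult_ac)
  also have "\<dots> = c * (n choose k) * ?d n * (n choose t) * (?d (n - t) * ?d t)"
    by (simp only: mult_ac)
  also have "\<dots> = c * (2 * n choose (2 * k)) * (n choose t) * (?d (n - k) * ?d k) * (?d (n - t) * ?d t)"
    using binomial_double_fact[OF kt(2)] by (simp add: mult_ac)
  also have "\<dots> = (n choose k) * (2 * n choose (2 * t)) * (?d (n - t) * ?d t) * (?d (n - k) * ?d k)"
    unfolding Ck Ct by (simp only: mult_ac)
  also have "\<dots> = ?x * (?d (n - k) * ?d k)"
    using binomial_double_fact[OF kt(3)] by (simp add: mult_ac)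
  finally have "?x * (c * (?d (n - t) * ?d t)) = ?x * (?d (n - k) * ?d k)" .
  moreover have "?x \<noteq> 0" using kt double_fact_pos[of "2 * n - 1"] by simp
  ultimately have quot: "?d (n - k) * ?d k = c * (?d (n - t) * ?d t)"
    by (metis mult_left_cancel)
  let ?P = "\<Prod>j=k+1..t. 2 * int j - 1" and ?Q = "\<Prod>j=k+1..t. 2 * int n - (2 * int j - 1)"
  have "int (?d (n - k) * ?d k) = int (c * (?d (n - t) * ?d t))"
    by (simp only: quot)
  then have "?Q * int (?d (n - t)) * int (?d k) = int c * (int (?d (n - t)) * (?P * int (?d k)))"
    by (simp only: of_nat_mult double_fact_odd_prod[OF kt(1)] double_fact_odd_prod_reflected[OF kt(1,3)])
  \<comment> \<open>The factors \<open>?d (n - t)\<close> and \<open>?d k\<close> are common to both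
    sides; cancelling them exhibits \<open>c\<close> as the cofactor in the divisibility.\<close>
  then have "(int (?d (n - t)) * int (?d k)) * ?Q = (int (?d (n - t)) * int (?d k)) * (?P * int c)"
    by (simp only: mult_ac)
  then have "?Q = ?P * int c"
    by (subst (asm) mult_left_cancel) (simp_all add: double_fact_pos less_imp_neq[THEN not_sym])
  moreover have "of_nat (?d (n - k) * ?d k) / of_nat (?d (n - t) * ?d t) = (of_nat c :: rat)"
    unfolding quot using double_fact_pos[of "2 * (n - t) - 1"] double_fact_pos[of "2 * t - 1"] by simp
  ultimately show "?P dvd ?Q \<and> (of_nat (?d (n - k) * ?d k) / of_nat (?d (n - t) * ?d t) :: rat) \<in> \<int>"
    by simp
qed

end
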